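(* Let $n\ge 1$ be an integer and let $Y=(y_1,\dots,y_n)^T\in\mathbb{R}^n$ satisfy $y_i>0$ for all $i$ and $\sum_{i=1}^n y_i=1$. Consider the function $$L(\hat Y)=\sum_{i=1}^n\frac{\hat y_i^2}{y_i}-1$$ on the set of all $\hat Y=(\hat y_1,\dots,\hat y_n)^T\in\mathbb{R}^n$ with $\hat y_i>0$ for all $i$ and $\sum_{i=1}^n\hat y_i=1$. Then $$\mathop{\arg\min}_{\hat Y} L(\hat Y)=Y,$$ that is, $\hat Y=Y$ is the unique global minimizer of $L$ over this set.
   Context: The function $L(\hat Y)=\sum_{i=1}^n \hat y_i^2/y_i-1$ is called the chi-square loss; $Y$ is the (smoothed) true label distribution and $\hat Y$ is the predicted distribution over $n$ classes. *)

theory Defs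
  imports "HOL-Analysis.Analysis"
begin

definition chi_square_loss :: "real ^ 'n \<Rightarrow> real ^ 'n \<Rightarrow> real" where
  "chi_square_loss Y Z = (\<Sum>i\<in>UNIV. (Z $ i)\<^sup>2 / Y $ i) - 1"

definition positive_distributions :: "(real ^ 'n) set" where
  "positive_distributions = {Z. (\<forall>i. 0 < Z $ i) \<and> (\<Sum>i\<in>UNIV. Z $ i) = 1}"

end

theory Submission
  imports Defs
begin

text \<open>Completing the square: summing
  \<open>(z - y)\<^sup>2 / y = z\<^sup>2 / y - 2 * z + y\<close> over the coordinates, unit masses
  turn the linear terms into -2 + 1 = -1, the constant in the loss. So the loss is a sum of squares
  with positive weights: zero at \<open>Y\<close> (\<open>chi_square_loss_self\<close>), positive
  elsewhere (\<open>chi_square_loss_pos\<close>).\<close>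

text \<open>On vectors of total mass one the loss is the chi-square divergence
  $\sum_i (\hat y_i - y_i)^2 / y_i$, a positive definite quadratic form in $\hat Y - Y$.\<close>

lemma chi_square_loss_eq_divergence:
  fixes Y Z :: "real ^ 'n"
  assumes "\<forall>i. Y $ i \<noteq> 0"
    and "(\<Sum>i\<in>UNIV. Y $ i) = 1" and "(\<Sum>i\<in>UNIV. Z $ i) = 1"
  shows "chi_square_loss Y Z = (\<Sum>i\<in>UNIV. (Z $ i - Y $ i)\<^sup>2 / Y $ i)"
proof -
  have "(Z $ i - Y $ i)\<^sup>2 / Y $ i = (Z $ i)\<^sup>2 / Y $ i - 2 * Z $ i + Y $ i" for i
    using assms(1) by (simp add: power2_eq_square field_simps)
  then show ?thesis
    using assms(2,3)
    by (simp add: chi_square_loss_def sum.distrib sum_subtractf flip: sum_distrib_left)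
qed

lemma chi_square_loss_self:
  fixes Y :: "real ^ 'n"
  assumes "\<forall>i. Y $ i \<noteq> 0" and "(\<Sum>i\<in>UNIV. Y $ i) = 1"
  shows "chi_square_loss Y Y = 0"
  using chi_square_loss_eq_divergence[OF assms assms(2)] by simp

lemma chi_square_loss_pos:
  fixes Y Z :: "real ^ 'n"
  assumes pos: "\<forall>i. 0 < Y $ i"
    and sums: "(\<Sum>i\<in>UNIV. Y $ i) = 1" "(\<Sum>i\<in>UNIV. Z $ i) = 1"
    and "Z \<noteq> Y"
  shows "0 < chi_square_loss Y Z"
proof -
  \<comment> \<open>One differing coordinate gives a strictly positive term; the others cannot
    cancel it.\<close>
  obtain i where "Z $ i \<noteq> Y $ i"
    using \<open>Z \<noteq> Y\<close> by (auto simp: vec_eq_iff)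
  with pos have "0 < (Z $ i - Y $ i)\<^sup>2 / Y $ i"
    by simp
  moreover have "0 \<le> (Z $ j - Y $ j)\<^sup>2 / Y $ j" for j
    using pos by (simp add: less_imp_le)
  ultimately have "0 < (\<Sum>j\<in>UNIV. (Z $ j - Y $ j)\<^sup>2 / Y $ j)"
    by (intro sum_pos2[where i = i]) auto
  moreover have "\<forall>i. Y $ i \<noteq> 0"
    using pos by (metis less_irrefl)
  ultimately show ?thesis
    using sums by (simp add: chi_square_loss_eq_divergence)
qed

theorem theorem1:
  fixes Y :: "real ^ 'n"
  assumes "\<forall>i. 0 < Y $ i"
    and "(\<Sum>i\<in>UNIV. Y $ i) = 1"
  shows "{Z. is_arg_min (chi_square_loss Y) (\<lambda>Z. Z \<in> positive_distributions) Z} = {Y}"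
proof -
  have Y: "Y \<in> positive_distributions"
    using assms by (simp add: positive_distributions_def)
  have "\<forall>i. Y $ i \<noteq> 0"
    using assms(1) by (metis less_irrefl)
  then have "chi_square_loss Y Y = 0"
    using assms(2) by (rule chi_square_loss_self)
  then have less: "chi_square_loss Y Y < chi_square_loss Y Z"
    if "Z \<in> positive_distributions" "Z \<noteq> Y" for Z
    using that chi_square_loss_pos[OF assms] by (simp add: positive_distributions_def)
  \<comment> \<open>\<open>is_arg_min\<close> forbids a strictly better feasible point:
    \<open>Y\<close> itself rules out any other \<open>Z\<close>, and by asymmetry of
    \<open><\<close> nothing beats \<open>Y\<close>.\<close>
  have "is_arg_min (chi_square_loss Y) (\<lambda>Z. Z \<in> positive_distributions) Z \<longleftrightarrow> Z = Y" for Z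
    unfolding is_arg_min_def using Y less by (metis less_asym less_irrefl)
  then show ?thesis
    by simp
qed

end
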